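(* Let $BD=(T,A,\{f_p:p\in A^P\})$ be basic data with associated $2$-graph $\Lambda_{BD}$ and shift space $$Y_{BD}=\{y\in A^{\mathbb Z^2}: y\downarrow_{T+n}\in\Lambda_{BD}^0\text{ for every }n\in\mathbb Z^2\}.$$ Then the topological entropy of $\Lambda_{BD}$, and hence of $Y_{BD}$, is zero: $$h(\Lambda_{BD})=\lim_{d\to\infty}\frac1{2^d}\log|\Lambda_{BD}^{(d,d)}|=0\quad\text{and}\quad h(Y_{BD})=\lim_{d\to\infty}\frac1{2^d}\log|\mathcal B_d(Y_{BD})|=0.$$
   Context: $\mathbb N=\{0,1,2,\dots\}$; $\mathbb N^2$ is a semigroup under addition with basis $e_1,e_2$ and the coordinatewise partial order $\le$. A tile $T$ is a nonempty finite subset of $\mathbb N^2$ that is hereditary ($n\in T$ and $0\le m\le n$ imply $m\in T$); $(c_1,c_2)$ denotes the coordinatewise maximum of the elements of $T$; $T$ is nondegenerate if $|T|\ge 2$. For nondegenerate $T$ put $P=T\setminus\{c_1e_1,c_2e_2\}$. Basic data is a triple $BD=(T,A,\{f_p:p\in A^P\})$ where $T$ is a nondegenerate tile, $A$ is a finite nonempty set, and for each function $p\in A^P$ (with $A^\emptyset=\{\emptyset\}$), $f_p:A\to A$ is a bijection. For $p\in A^P$, $a\in A$ define $F_{p,a}:T\to A$ by $F_{p,a}(c_2e_2)=a$, $F_{p,a}(c_1e_1)=f_p(a)$, $F_{p,a}(t)=p(t)$ for $t\in P$, and let $\Lambda_{BD}^0=\{F_{p,a}:p\in A^P,a\in A\}$.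 $S+n=\{m+n:m\in S\}$; for $n\in\mathbb N^2$, $T(n)=\bigcup_{0\le m\le n}(T+m)$. If $f:S\to A$ with $T+n\subset S$, define $f\downarrow_{T+n}:T\to A$ by $f\downarrow_{T+n}(i)=f(i+n)$. $\Lambda_{BD}^n$, the set of paths of degree $n\in\mathbb N^2$ in $\Lambda_{BD}$, is the set of functions $\lambda:T(n)\to A$ with $\lambda\downarrow_{T+m}\in\Lambda_{BD}^0$ for all $0\le m\le n$. For a shift space $X\subset A^{\mathbb Z^2}$ (nonempty and invariant under all translations $\sigma_b(x)(m)=x(m+b)$, $b\in\mathbb Z^2$), $\mathcal B_d(X)$ is the set of all $d\times d$ square configurations occurring in elements of $X$, and the topological entropy is, by the paper's definition, $h(X)=\lim_{d\to\infty}\frac1{2^d}\log|\mathcal B_d(X)|$. For the $2$-graph $\Lambda_{BD}$ the paper takes $|\mathcal B_d(\Lambda_{BD})|=|\Lambda_{BD}^{(d,d)}|$. *)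

theory Defs
  imports Complex_Main "HOL-Library.FuncSet" "HOL-Library.Product_Plus"
    "HOL-Library.Product_Order"
begin

text \<open>On pairs, addition and \<open>\<le>\<close> are coordinatewise (\<open>Product_Plus\<close>, \<open>Product_Order\<close>). A
  function \<open>S \<rightarrow> A\<close> is an element of \<open>S \<rightarrow>\<^sub>E A\<close>, i.e. it is \<open>undefined\<close> off \<open>S\<close>, so that equality
  and cardinality of sets of such functions are the intended ones.\<close>

definition tile :: "(nat \<times> nat) set \<Rightarrow> bool" where
  "tile T \<longleftrightarrow> finite T \<and> T \<noteq> {} \<and> (\<forall>n\<in>T. \<forall>m\<le>n. m \<in> T)"

definition nondegenerate_tile :: "(nat \<times> nat) set \<Rightarrow> bool" where
  "nondegenerate_tile T \<longleftrightarrow> tile T \<and> card T \<ge> 2"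

definition c1 :: "(nat \<times> nat) set \<Rightarrow> nat" where "c1 T = Max (fst ` T)"
definition c2 :: "(nat \<times> nat) set \<Rightarrow> nat" where "c2 T = Max (snd ` T)"

definition P_of :: "(nat \<times> nat) set \<Rightarrow> (nat \<times> nat) set" where
  "P_of T = T - {(c1 T, 0), (0, c2 T)}"

definition basic_data ::
    "(nat \<times> nat) set \<Rightarrow> 'a set \<Rightarrow> ((nat \<times> nat \<Rightarrow> 'a) \<Rightarrow> 'a \<Rightarrow> 'a) \<Rightarrow> bool" where
  "basic_data T A f \<longleftrightarrow> nondegenerate_tile T \<and> finite A \<and> A \<noteq> {} \<and>
     (\<forall>p \<in> P_of T \<rightarrow>\<^sub>E A. bij_betw (f p) A A)"

definition vertex_fun :: "(nat \<times> nat) set \<Rightarrow> ((nat \<times> nat \<Rightarrow> 'a) \<Rightarrow> 'a \<Rightarrow> 'a) \<Rightarrow>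
    (nat \<times> nat \<Rightarrow> 'a) \<Rightarrow> 'a \<Rightarrow> (nat \<times> nat \<Rightarrow> 'a)" where
  "vertex_fun T f p a =
     (\<lambda>t\<in>T. if t = (0, c2 T) then a else if t = (c1 T, 0) then f p a else p t)"

definition vertices :: "(nat \<times> nat) set \<Rightarrow> 'a set \<Rightarrow> ((nat \<times> nat \<Rightarrow> 'a) \<Rightarrow> 'a \<Rightarrow> 'a) \<Rightarrow>
    (nat \<times> nat \<Rightarrow> 'a) set" where
  "vertices T A f = {vertex_fun T f p a | p a. p \<in> P_of T \<rightarrow>\<^sub>E A \<and> a \<in> A}"

definition tile_union :: "(nat \<times> nat) set \<Rightarrow> nat \<times> nat \<Rightarrow> (nat \<times> nat) set" where
  "tile_union T n = (\<Union>m\<in>{0..n}. (\<lambda>t. t + m) ` T)"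

definition tile_window :: "(nat \<times> nat) set \<Rightarrow> (nat \<times> nat \<Rightarrow> 'a) \<Rightarrow> nat \<times> nat \<Rightarrow>
    (nat \<times> nat \<Rightarrow> 'a)" where
  "tile_window T g n = (\<lambda>i\<in>T. g (i + n))"

text \<open>The set of paths of degree \<open>n\<close> in the 2-graph of the basic data.\<close>

definition paths :: "(nat \<times> nat) set \<Rightarrow> 'a set \<Rightarrow> ((nat \<times> nat \<Rightarrow> 'a) \<Rightarrow> 'a \<Rightarrow> 'a) \<Rightarrow>
    nat \<times> nat \<Rightarrow> (nat \<times> nat \<Rightarrow> 'a) set" where
  "paths T A f n = {l \<in> tile_union T n \<rightarrow>\<^sub>E A. \<forall>m\<in>{0..n}. tile_window T l m \<in> vertices T A f}"

definition translate :: "int \<times> int \<Rightarrow> (int \<times> int \<Rightarrow> 'a) \<Rightarrow> (int \<times> int \<Rightarrow> 'a)" where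
  "translate b x = (\<lambda>m. x (m + b))"

definition shift_space :: "'a set \<Rightarrow> (int \<times> int \<Rightarrow> 'a) set \<Rightarrow> bool" where
  "shift_space A X \<longleftrightarrow> X \<subseteq> (UNIV \<rightarrow> A) \<and> X \<noteq> {} \<and> (\<forall>b. \<forall>x\<in>X. translate b x \<in> X)"

text \<open>Restriction to \<open>S + b\<close>, read off as a function on \<open>S\<close>, of a configuration on the
  integer lattice.\<close>

definition lattice_window :: "(nat \<times> nat) set \<Rightarrow> (int \<times> int \<Rightarrow> 'a) \<Rightarrow> int \<times> int \<Rightarrow>
    (nat \<times> nat \<Rightarrow> 'a)" where
  "lattice_window S x b = (\<lambda>i\<in>S. x (map_prod int int i + b))"

definition Y_BD :: "(nat \<times> nat) set \<Rightarrow> 'a set \<Rightarrow> ((nat \<times> nat \<Rightarrow> 'a) \<Rightarrow> 'a \<Rightarrow> 'a) \<Rightarrow>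
    (int \<times> int \<Rightarrow> 'a) set" where
  "Y_BD T A f = {y \<in> UNIV \<rightarrow> A. \<forall>n. lattice_window T y n \<in> vertices T A f}"

definition square_blocks :: "nat \<Rightarrow> (int \<times> int \<Rightarrow> 'a) set \<Rightarrow> (nat \<times> nat \<Rightarrow> 'a) set" where
  "square_blocks d X = {lattice_window ({..<d} \<times> {..<d}) x b | x b. x \<in> X}"

text \<open>The normalisation \<open>1 / 2 ^ d\<close> (rather than \<open>1 / d\<^sup>2\<close>) is the one of the source.
  \<^const>\<open>lim\<close> is only meaningful for convergent sequences, so statements about these
  entropies should also assert convergence.\<close>

definition graph_entropy ::
    "(nat \<times> nat) set \<Rightarrow> 'a set \<Rightarrow> ((nat \<times> nat \<Rightarrow> 'a) \<Rightarrow> 'a \<Rightarrow> 'a) \<Rightarrow> real" where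
  "graph_entropy T A f = lim (\<lambda>d. 1 / 2 ^ d * ln (real (card (paths T A f (d, d)))))"

definition shift_entropy :: "(int \<times> int \<Rightarrow> 'a) set \<Rightarrow> real" where
  "shift_entropy X = lim (\<lambda>d. 1 / 2 ^ d * ln (real (card (square_blocks d X))))"

end

theory Submission
  imports Defs "HOL-Real_Asymp.Real_Asymp"
begin

text \<open>
  Both entropies vanish by counting alone. A path of degree \<open>(d, d)\<close> is an \<open>A\<close>-valued function on
  a set of at most \<open>(c\<^sub>1 + d + 1) (c\<^sub>2 + d + 1)\<close> points, and a \<open>d \<times> d\<close> block of \<open>Y\<^sub>B\<^sub>D\<close> one on \<open>d\<^sup>2\<close>
  points, so the logarithms of the cardinalities grow at most quadratically, whereas they are divided
  by \<open>2 ^ d\<close> (\<open>exp_normalised_log_card_tendsto_0\<close>).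

  The substance lies in \<open>Y\<^sub>B\<^sub>D\<close> being nonempty (\<open>Y_BD_nonempty\<close>). A configuration \<open>y\<close> belongs to
  \<open>Y\<^sub>B\<^sub>D\<close> iff for every \<open>n\<close> the value at the corner \<open>n + c\<^sub>1 e\<^sub>1\<close> is the image of the value at the
  corner \<open>n + c\<^sub>2 e\<^sub>2\<close> under the bijection \<open>f\<^sub>p\<close>, where \<open>p\<close> is read off the rest of \<open>T + n\<close>. Thus
  either corner is determined by the other points of the translated tile. The linear functional
  \<open>\<phi> (i, j) = (c\<^sub>2 + 1) i - j\<close> attains its maximum on \<open>T\<close> only at \<open>c\<^sub>1 e\<^sub>1\<close> and its minimum only
  at \<open>c\<^sub>2 e\<^sub>2\<close>. Let \<open>W > 0\<close> be the difference of these two values. Fill the strip \<open>0 \<le> \<phi> < W\<close> with a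
  constant, extend to \<open>\<phi> \<ge> W\<close> by the maps \<open>f\<^sub>p\<close>, in order of increasing \<open>\<phi>\<close>, and extend to
  \<open>\<phi> < 0\<close> by their inverses, in order of decreasing \<open>\<phi>\<close>. As the values of \<open>\<phi>\<close> at the two
  corners of a translate of \<open>T\<close> differ by \<open>W\<close>, the larger is at least \<open>W\<close> or the smaller is
  negative, and the extension makes the condition of that translate hold.
\<close>

section \<open>Tiles and their corners\<close>

lemma c_bounds:
  assumes "tile T" "t \<in> T"
  shows "fst t \<le> c1 T" "snd t \<le> c2 T"
  using assms by (auto simp: tile_def c1_def c2_def)

lemma corners_in_tile:
  assumes "tile T"
  shows "(c1 T, 0) \<in> T" "(0, c2 T) \<in> T"
proof -
  have fin: "finite T" and ne: "T \<noteq> {}" and her: "\<And>n m. n \<in> T \<Longrightarrow> m \<le> n \<Longrightarrow> m \<in> T"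
    using assms by (auto simp: tile_def)
  have "c1 T \<in> fst ` T" unfolding c1_def using fin ne by (intro Max_in) auto
  then obtain n where "n \<in> T" "fst n = c1 T" by auto
  then show "(c1 T, 0) \<in> T" using her by (auto simp: less_eq_prod_def)
  have "c2 T \<in> snd ` T" unfolding c2_def using fin ne by (intro Max_in) auto
  then obtain n where "n \<in> T" "snd n = c2 T" by auto
  then show "(0, c2 T) \<in> T" using her by (auto simp: less_eq_prod_def)
qed

lemma corners_not_both_0:
  assumes "nondegenerate_tile T"
  shows "c1 T > 0 \<or> c2 T > 0"
proof (rule ccontr)
  assume "\<not> ?thesis"
  moreover have "tile T" using assms by (simp add: nondegenerate_tile_def)
  ultimately have "T \<subseteq> {(0, 0)}" using c_bounds by fastforce
  then have "card T \<le> card {(0::nat, 0::nat)}" by (intro card_mono) auto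
  then show False using assms by (simp add: nondegenerate_tile_def)
qed

section \<open>The shift space is nonempty\<close>

definition level :: "(nat \<times> nat) set \<Rightarrow> int \<times> int \<Rightarrow> int" where
  "level T z = (int (c2 T) + 1) * fst z - snd z"

definition level_width :: "(nat \<times> nat) set \<Rightarrow> int" where
  "level_width T = level T (int (c1 T), 0) - level T (0, int (c2 T))"

lemma level_add: "level T (x + y) = level T x + level T y"
  by (simp add: level_def algebra_simps)

lemma level_width_pos:
  assumes "nondegenerate_tile T"
  shows "level_width T > 0"
  using corners_not_both_0[OF assms]
  by (auto simp: level_width_def level_def intro: add_nonneg_pos add_pos_nonneg)

text \<open>The weight \<open>c\<^sub>2 + 1\<close> exceeds every second coordinate in \<open>T\<close>, so moving one column to the
  right outweighs any vertical move, and levels order \<open>T\<close> by columns, upper points first.\<close>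

lemma level_le_corner:
  assumes "tile T" "t \<in> T"
  shows "level T (map_prod int int t) \<le> level T (int (c1 T), 0)"
    and "t \<noteq> (c1 T, 0) \<Longrightarrow> level T (map_prod int int t) < level T (int (c1 T), 0)"
proof -
  obtain i j where t: "t = (i, j)" by (cases t)
  have "i \<le> c1 T" using c_bounds[OF assms] t by simp
  then have "(int (c2 T) + 1) * int i \<le> (int (c2 T) + 1) * int (c1 T)"
    by (intro mult_left_mono) auto
  then show "level T (map_prod int int t) \<le> level T (int (c1 T), 0)"
    unfolding level_def t map_prod_simp fst_conv snd_conv by linarith
  assume "t \<noteq> (c1 T, 0)"
  then consider "i < c1 T" | "i = c1 T" "j > 0" using \<open>i \<le> c1 T\<close> t by force
  then show "level T (map_prod int int t) < level T (int (c1 T), 0)"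
  proof cases
    case 1
    then have "(int (c2 T) + 1) * int i < (int (c2 T) + 1) * int (c1 T)"
      by (intro mult_strict_left_mono) auto
    then show ?thesis unfolding level_def t map_prod_simp fst_conv snd_conv by linarith
  qed (simp add: level_def t)
qed

lemma corner_le_level:
  assumes "tile T" "t \<in> T"
  shows "level T (0, int (c2 T)) \<le> level T (map_prod int int t)"
    and "t \<noteq> (0, c2 T) \<Longrightarrow> level T (0, int (c2 T)) < level T (map_prod int int t)"
proof -
  obtain i j where t: "t = (i, j)" by (cases t)
  have j: "j \<le> c2 T" using c_bounds[OF assms] t by simp
  have nn: "(int (c2 T) + 1) * int i \<ge> 0" by simp
  show "level T (0, int (c2 T)) \<le> level T (map_prod int int t)"
    using j nn unfolding level_def t map_prod_simp fst_conv snd_conv by linarith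
  assume "t \<noteq> (0, c2 T)"
  then consider "i > 0" | "i = 0" "j < c2 T" using j t by force
  then show "level T (0, int (c2 T)) < level T (map_prod int int t)"
  proof cases
    case 1
    then have "(int (c2 T) + 1) * int i > 0" by simp
    then show ?thesis using j by (simp add: level_def t)
  qed (simp add: level_def t)
qed

text \<open>The order in which the plane is filled: \<open>0, 1, 2, \<dots>\<close> upwards, and downwards from level
  \<open>-1\<close>, whose rank \<open>W + 1\<close> (with \<open>W\<close> for \<^const>\<open>level_width\<close>) exceeds those of the levels
  \<open>0, \<dots>, W - 1\<close> that it depends on.\<close>

definition level_rank :: "(nat \<times> nat) set \<Rightarrow> int \<times> int \<Rightarrow> nat" where
  "level_rank T z = nat (if level T z < 0 then level_width T - level T z else level T z)"

lemma level_rank_less_up: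
  assumes "level T z \<ge> level_width T" "level T z - level_width T \<le> level T w" "level T w < level T z"
  shows "level_rank T w < level_rank T z"
  using assms by (auto simp: level_rank_def)

lemma level_rank_less_down:
  assumes "level T z < 0" "level T z < level T w" "level T w \<le> level T z + level_width T"
  shows "level_rank T w < level_rank T z"
  using assms by (auto simp: level_rank_def)

text \<open>A fixed point of this operator solves the corner equation of every translate of the tile: the
  first branch does so from the corner \<open>c\<^sub>2 e\<^sub>2\<close>, the second from \<open>c\<^sub>1 e\<^sub>1\<close>. The constant
  is the content of the initial strip.\<close>

definition corner_step :: "(nat \<times> nat) set \<Rightarrow> 'a set \<Rightarrow> ((nat \<times> nat \<Rightarrow> 'a) \<Rightarrow> 'a \<Rightarrow> 'a) \<Rightarrow> 'a \<Rightarrow>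
    (int \<times> int \<Rightarrow> 'a) \<Rightarrow> int \<times> int \<Rightarrow> 'a" where
  "corner_step T A f a0 g z =
    (if level T z \<ge> level_width T then
       (let n = z - (int (c1 T), 0)
        in f (lattice_window (P_of T) g n) (g ((0, int (c2 T)) + n)))
     else if level T z < 0 then
       (let n = z - (0, int (c2 T))
        in inv_into A (f (lattice_window (P_of T) g n)) (g ((int (c1 T), 0) + n)))
     else a0)"

lemma lattice_window_in_PiE:
  "g \<in> UNIV \<rightarrow> A \<Longrightarrow> lattice_window S g n \<in> S \<rightarrow>\<^sub>E A"
  by (auto simp: lattice_window_def)

text \<open>A window of a configuration prescribes its own \<open>p\<close> and its own value at \<open>c\<^sub>2 e\<^sub>2\<close>, so only
  the value at \<open>c\<^sub>1 e\<^sub>1\<close> is constrained.\<close>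

lemma lattice_window_in_verticesI:
  assumes y: "y \<in> UNIV \<rightarrow> A"
    and eq: "y ((int (c1 T), 0) + n) = f (lattice_window (P_of T) y n) (y ((0, int (c2 T)) + n))"
  shows "lattice_window T y n \<in> vertices T A f"
proof -
  let ?p = "lattice_window (P_of T) y n" and ?a = "y ((0, int (c2 T)) + n)"
  have "lattice_window T y n = vertex_fun T f ?p ?a"
    using eq by (fastforce simp: lattice_window_def vertex_fun_def P_of_def fun_eq_iff restrict_def)
  moreover have "?p \<in> P_of T \<rightarrow>\<^sub>E A" using y by (rule lattice_window_in_PiE)
  moreover have "?a \<in> A" using y by auto
  ultimately show ?thesis unfolding vertices_def by blast
qed

text \<open>The step function consults its argument only at points of strictly smaller rank: the other
  points of the translated tile lie within \<open>W\<close> of the corner being filled, on the side that is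
  already known.\<close>

lemma corner_step_cong:
  assumes T: "tile T" "nondegenerate_tile T"
    and gh: "\<And>w. level_rank T w < level_rank T z \<Longrightarrow> g w = h w"
  shows "corner_step T A f a0 g z = corner_step T A f a0 h z"
proof -
  note lw = level_width_def[of T]
  have above: "g (map_prod int int t + (z - (int (c1 T), 0))) = h (map_prod int int t + (z - (int (c1 T), 0)))"
    if "level T z \<ge> level_width T" "t \<in> T" "t \<noteq> (c1 T, 0)" for t
  proof (rule gh, rule level_rank_less_up[OF that(1)])
    have "level T z = level T (int (c1 T), 0) + level T (z - (int (c1 T), 0))"
      by (simp flip: level_add)
    then show "level T z - level_width T \<le> level T (map_prod int int t + (z - (int (c1 T), 0)))"
      and "level T (map_prod int int t + (z - (int (c1 T), 0))) < level T z"
      using level_le_corner(2)[OF T(1) that(2,3)] corner_le_level(1)[OF T(1) that(2)]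
      by (auto simp only: level_add lw)
  qed
  have below: "g (map_prod int int t + (z - (0, int (c2 T)))) = h (map_prod int int t + (z - (0, int (c2 T))))"
    if "level T z < 0" "t \<in> T" "t \<noteq> (0, c2 T)" for t
  proof (rule gh, rule level_rank_less_down[OF that(1)])
    have "level T z = level T (0, int (c2 T)) + level T (z - (0, int (c2 T)))"
      by (simp flip: level_add)
    then show "level T z < level T (map_prod int int t + (z - (0, int (c2 T))))"
      and "level T (map_prod int int t + (z - (0, int (c2 T)))) \<le> level T z + level_width T"
      using corner_le_level(2)[OF T(1) that(2,3)] level_le_corner(1)[OF T(1) that(2)]
      by (auto simp only: level_add lw)
  qed
  have ne: "(0, c2 T) \<noteq> (c1 T, 0)" "(c1 T, 0) \<noteq> (0, c2 T)"
    using corners_not_both_0[OF T(2)] by auto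
  consider (up) "level T z \<ge> level_width T" | (down) "\<not> level T z \<ge> level_width T" "level T z < 0"
    | (mid) "\<not> level T z \<ge> level_width T" "\<not> level T z < 0" by linarith
  then show ?thesis
  proof cases
    case up
    have "lattice_window (P_of T) g (z - (int (c1 T), 0)) = lattice_window (P_of T) h (z - (int (c1 T), 0))"
      unfolding lattice_window_def by (rule restrict_ext, rule above[OF up]) (auto simp: P_of_def)
    moreover have "g ((0, int (c2 T)) + (z - (int (c1 T), 0))) = h ((0, int (c2 T)) + (z - (int (c1 T), 0)))"
      using above[OF up corners_in_tile(2)[OF T(1)] ne(1)] by simp
    ultimately show ?thesis using up by (simp only: corner_step_def Let_def if_True if_False)
  next
    case down
    have "lattice_window (P_of T) g (z - (0, int (c2 T))) = lattice_window (P_of T) h (z - (0, int (c2 T)))"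
      unfolding lattice_window_def by (rule restrict_ext, rule below[OF down(2)]) (auto simp: P_of_def)
    moreover have "g ((int (c1 T), 0) + (z - (0, int (c2 T)))) = h ((int (c1 T), 0) + (z - (0, int (c2 T))))"
      using below[OF down(2) corners_in_tile(1)[OF T(1)] ne(2)] by simp
    ultimately show ?thesis using down by (simp only: corner_step_def Let_def if_True if_False)
  qed (simp add: corner_step_def)
qed

lemma corner_step_in:
  assumes "basic_data T A f" "a0 \<in> A" and g: "g \<in> UNIV \<rightarrow> A"
  shows "corner_step T A f a0 g z \<in> A"
proof -
  have bij: "bij_betw (f (lattice_window (P_of T) g n)) A A" for n
    using assms(1) lattice_window_in_PiE[OF g] by (simp add: basic_data_def)
  have gA: "g n \<in> A" for n using g by auto
  have "f (lattice_window (P_of T) g n) (g m) \<in> A"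
    and "inv_into A (f (lattice_window (P_of T) g n)) (g m) \<in> A" for n m
    using bij_betwE[OF bij] bij_betwE[OF bij_betw_inv_into[OF bij]] gA by auto
  then show ?thesis using assms(2) unfolding corner_step_def Let_def by (simp only: split: if_split) simp
qed

lemma corner_step_fixpoint:
  assumes BD: "basic_data T A f" and a0: "a0 \<in> A"
  obtains y where "y \<in> UNIV \<rightarrow> A" "\<And>z. y z = corner_step T A f a0 y z"
proof -
  have T: "tile T" "nondegenerate_tile T"
    using BD by (auto simp: basic_data_def nondegenerate_tile_def)
  define R where "R = measure (level_rank T)"
  define y where "y = wfrec R (corner_step T A f a0)"
  have fix_y: "y z = corner_step T A f a0 y z" for z
  proof -
    have "y z = corner_step T A f a0 (cut y R z) z"
      unfolding y_def by (rule wfrec) (simp add: R_def)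
    also have "\<dots> = corner_step T A f a0 y z"
      by (rule corner_step_cong[OF T]) (simp add: cut_def R_def)
    finally show ?thesis .
  qed
  have "y z \<in> A" for z
  proof (induction z rule: measure_induct_rule[of "level_rank T"])
    case (less z)
    \<comment> \<open>Values of higher rank are not yet known to be in \<open>A\<close>, but do not influence the step.\<close>
    define g where "g = (\<lambda>w. if level_rank T w < level_rank T z then y w else a0)"
    have "y z = corner_step T A f a0 g z"
      unfolding fix_y[of z] by (rule corner_step_cong[OF T]) (simp add: g_def)
    also have "\<dots> \<in> A"
      by (rule corner_step_in[OF BD a0]) (use less a0 in \<open>simp add: g_def\<close>)
    finally show ?case .
  qed
  then show ?thesis using fix_y that by blast
qed

lemma Y_BD_nonempty:
  assumes BD: "basic_data T A f"
  shows "Y_BD T A f \<noteq> {}"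
proof -
  obtain a0 where a0: "a0 \<in> A" using BD by (auto simp: basic_data_def)
  obtain y where y: "y \<in> UNIV \<rightarrow> A" and fix_y: "\<And>z. y z = corner_step T A f a0 y z"
    using corner_step_fixpoint[OF BD a0] by blast
  have "lattice_window T y n \<in> vertices T A f" for n
  proof (rule lattice_window_in_verticesI[OF y])
    let ?u = "(int (c1 T), 0) + n" and ?v = "(0, int (c2 T)) + n"
    let ?p = "lattice_window (P_of T) y n"
    have bij: "bij_betw (f ?p) A A"
      using BD lattice_window_in_PiE[OF y] by (simp add: basic_data_def)
    have diff: "level T ?u = level T ?v + level_width T"
      by (simp only: level_add level_width_def)
    show "y ?u = f ?p (y ?v)"
    proof (cases "level T ?u \<ge> level_width T")
      case True
      then show ?thesis using fix_y[of ?u] by (simp add: corner_step_def Let_def)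
    next
      case False
      with diff have neg: "level T ?v < 0" by simp
      moreover have "\<not> level T ?v \<ge> level_width T"
        using neg level_width_pos[of T] BD by (simp add: basic_data_def)
      ultimately have "y ?v = inv_into A (f ?p) (y ?u)"
        using fix_y[of ?v] by (simp add: corner_step_def Let_def)
      moreover have "y ?u \<in> A" using y by auto
      ultimately show ?thesis using bij_betw_inv_into_right[OF bij] by simp
    qed
  qed
  then show ?thesis using y by (auto simp: Y_BD_def)
qed

lemma shift_space_Y_BD:
  assumes "basic_data T A f"
  shows "shift_space A (Y_BD T A f)"
proof -
  have "lattice_window T (translate b x) n = lattice_window T x (n + b)" for b n and x :: "int \<times> int \<Rightarrow> 'a"
    by (simp add: lattice_window_def translate_def add.assoc)
  then show ?thesis
    using Y_BD_nonempty[OF assms] by (auto simp: shift_space_def Y_BD_def translate_def)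
qed

section \<open>Counting\<close>

text \<open>If \<open>C d = 0\<close>, the convention \<open>ln 0 = 0\<close> makes the estimate hold.\<close>

lemma exp_normalised_log_card_tendsto_0:
  fixes C q :: "nat \<Rightarrow> nat"
  assumes C: "\<And>d. C d \<le> a ^ q d" and q: "(\<lambda>d. real (q d) / 2 ^ d) \<longlonglongrightarrow> 0"
  shows "(\<lambda>d. 1 / 2 ^ d * ln (real (C d))) \<longlonglongrightarrow> 0"
proof (rule tendsto_sandwich)
  have "0 \<le> ln (real (C d))" for d by (cases "C d") auto
  then show "\<forall>\<^sub>F d in sequentially. 0 \<le> 1 / 2 ^ d * ln (real (C d))" by simp
  have "ln (real (C d)) \<le> real (q d) * ln (real a)" for d
  proof (cases "C d = 0")
    case True
    then show ?thesis by (cases a) auto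
  next
    case False
    then have "0 < a ^ q d" using C[of d] by linarith
    then have "ln (real (C d)) \<le> ln (real (a ^ q d))"
      using False C[of d] by (subst ln_le_cancel_iff) (simp_all del: of_nat_power zero_less_power_eq)
    also have "\<dots> = real (q d) * ln (real a)" by (cases "a = 0") (auto simp: ln_realpow power_0_left)
    finally show ?thesis .
  qed
  then show "\<forall>\<^sub>F d in sequentially. 1 / 2 ^ d * ln (real (C d)) \<le> real (q d) / 2 ^ d * ln (real a)"
    by (simp add: divide_right_mono)
  show "(\<lambda>d. real (q d) / 2 ^ d * ln (real a)) \<longlonglongrightarrow> 0"
    using tendsto_mult_right[OF q, of "ln (real a)"] by simp
qed auto

lemma card_le_PiE:
  assumes "finite S" "finite A" "F \<subseteq> S \<rightarrow>\<^sub>E A"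
  shows "card F \<le> card A ^ card S"
  using card_mono[OF finite_PiE assms(3)] assms by (simp add: card_funcsetE)

lemma tile_union_subset:
  assumes "tile T"
  shows "tile_union T (d, e) \<subseteq> {..c1 T + d} \<times> {..c2 T + e}"
  using c_bounds[OF assms] by (fastforce simp: tile_union_def less_eq_prod_def)

lemma card_paths_le:
  assumes "tile T" "finite A" "A \<noteq> {}"
  shows "card (paths T A f (d, d)) \<le> card A ^ ((c1 T + d + 1) * (c2 T + d + 1))"
proof -
  have fin: "finite (tile_union T (d, d))"
    by (rule finite_subset[OF tile_union_subset[OF assms(1)]]) simp
  have "card (paths T A f (d, d)) \<le> card A ^ card (tile_union T (d, d))"
    by (rule card_le_PiE[OF fin assms(2)]) (auto simp: paths_def)
  also have "\<dots> \<le> card A ^ card ({..c1 T + d} \<times> {..c2 T + d})"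
    using assms(2,3) by (intro power_increasing card_mono tile_union_subset assms(1)) (auto simp: Suc_le_eq card_gt_0_iff)
  finally show ?thesis by (simp add: card_cartesian_product)
qed

lemma card_square_blocks_le:
  assumes "finite A" "X \<subseteq> UNIV \<rightarrow> A"
  shows "card (square_blocks d X) \<le> card A ^ (d * d)"
proof -
  have "square_blocks d X \<subseteq> {..<d} \<times> {..<d} \<rightarrow>\<^sub>E A"
    using assms(2) by (auto simp: square_blocks_def intro!: lattice_window_in_PiE)
  then show ?thesis
    using card_le_PiE[of "{..<d} \<times> {..<d}" A] assms(1) by (simp add: card_cartesian_product)
qed

theorem mainTheorem5:
  fixes T :: "(nat \<times> nat) set" and A :: "'a set"
    and f :: "(nat \<times> nat \<Rightarrow> 'a) \<Rightarrow> 'a \<Rightarrow> 'a"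
  assumes "basic_data T A f"
  shows "((\<lambda>d. 1 / 2 ^ d * ln (real (card (paths T A f (d, d))))) \<longlonglongrightarrow> graph_entropy T A f
           \<and> graph_entropy T A f = 0)
       \<and> shift_space A (Y_BD T A f)
       \<and> ((\<lambda>d. 1 / 2 ^ d * ln (real (card (square_blocks d (Y_BD T A f)))))
             \<longlonglongrightarrow> shift_entropy (Y_BD T A f)
           \<and> shift_entropy (Y_BD T A f) = 0)"
proof -
  have T: "tile T" and A: "finite A" "A \<noteq> {}"
    using assms by (auto simp: basic_data_def nondegenerate_tile_def)
  have "(\<lambda>d. real ((c1 T + d + 1) * (c2 T + d + 1)) / 2 ^ d) \<longlonglongrightarrow> 0"
    unfolding of_nat_mult of_nat_add of_nat_1 by real_asymp
  then have g: "(\<lambda>d. 1 / 2 ^ d * ln (real (card (paths T A f (d, d))))) \<longlonglongrightarrow> 0"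
    by (rule exp_normalised_log_card_tendsto_0[rotated]) (rule card_paths_le[OF T A])
  have "(\<lambda>d. real (d * d) / 2 ^ d) \<longlonglongrightarrow> 0"
    unfolding of_nat_mult by real_asymp
  then have s: "(\<lambda>d. 1 / 2 ^ d * ln (real (card (square_blocks d (Y_BD T A f))))) \<longlonglongrightarrow> 0"
    by (rule exp_normalised_log_card_tendsto_0[rotated])
      (rule card_square_blocks_le[OF A(1)], auto simp: Y_BD_def)
  have "graph_entropy T A f = 0" "shift_entropy (Y_BD T A f) = 0"
    using limI[OF g] limI[OF s] by (simp_all add: graph_entropy_def shift_entropy_def)
  then show ?thesis using g s shift_space_Y_BD[OF assms] by simp
qed

end
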